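(* Let $\mathbb{K}$ be a field of characteristic zero. Let $Q$ be a finite acyclic quiver, and let the length of the longest paths of $Q$ be $n-1$. Then $\operatorname{Id}(\mathbb{K}Q_{\geq 1}) = \langle x_1 x_2 \cdots x_n \rangle_{T_+}$.
   Context: A quiver $Q=(Q_0,Q_1,s,t)$ consists of a finite non-empty set $Q_0$ of vertices, a finite non-empty set $Q_1$ of arrows, and maps $s,t:Q_1\to Q_0$ (starting and terminal vertex). A path of length $\ell\ge 1$ is a sequence $p=\alpha_1\cdots\alpha_\ell$ of arrows with $t(\alpha_i)=s(\alpha_{i+1})$; $s(p)=s(\alpha_1)$, $t(p)=t(\alpha_\ell)$. $Q$ is acyclic if it has no oriented cycle, i.e. no path $p$ of length $\ge1$ with $s(p)=t(p)$. The principal subalgebra $\mathbb{K}Q_{\ge 1}$ is the (non-unital) $\mathbb{K}$-algebra with basis all paths of length $\ge 1$; the product of paths $p,q$ is the concatenation $pq$ if $t(p)=s(q)$ and $0$ otherwise. Let $X=\{x_1,x_2,\dots\}$ be countably many non-commuting variables, $\mathbb{K}\langle X\rangle$ the free associative algebra and $\mathbb{K}\langle X\rangle_+$ its subalgebra of polynomials with zero constant term. For a non-unital algebra $A$, $\operatorname{Id}(A)$ is the set of $f\in\mathbb{K}\langle X\rangle_+$ that vanish under every substitution of elements of $A$ for the variables. A T-ideal of $\mathbb{K}\langle X\rangle_+$ is a two-sided ideal stable under all endomorphisms of $\mathbb{K}\langle X\rangle_+$ (i.e. under substituting elements of $\mathbb{K}\langle X\rangle_+$ for the variables). For a non-empty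 $Z\subseteq \mathbb{K}\langle X\rangle_+$, $\langle Z\rangle_{T_+}$ is the T-ideal of $\mathbb{K}\langle X\rangle_+$ generated by $Z$. *)

theory Defs
  imports "HOL-Library.Poly_Mapping" Graph_Theory.Arc_Walk
begin

section \<open>The free associative algebra\<close>

text \<open>
  Words under concatenation, written additively: the convolution product of
  \<^theory>\<open>HOL-Library.Poly_Mapping\<close> then turns the finitely supported functions on
  words into the monoid algebra of the free monoid, i.e. the free associative algebra.
\<close>

datatype 'x word = Word (letters: "'x list")

instantiation word :: (type) monoid_add
begin

definition zero_word :: "'a word" where
  "zero_word = Word []"

definition plus_word :: "'a word \<Rightarrow> 'a word \<Rightarrow> 'a word" where
  "plus_word u v = Word (letters u @ letters v)"

instance
  by standard (simp_all add: zero_word_def plus_word_def)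

end

text \<open>The variable usually written \<open>x\<^sub>i\<close>, \<open>i \<ge> 1\<close>, has the index \<open>i - 1\<close> here.\<close>

type_synonym 'k free_algebra = "nat word \<Rightarrow>\<^sub>0 'k"

definition free_algebra_plus :: "'k::field free_algebra set" where
  "free_algebra_plus = {f. Poly_Mapping.lookup f 0 = 0}"

definition scale :: "'k::field \<Rightarrow> ('b \<Rightarrow>\<^sub>0 'k) \<Rightarrow> ('b \<Rightarrow>\<^sub>0 'k)" where
  "scale c f = Poly_Mapping.map ((*) c) f"

lemma lookup_scale [simp]: "Poly_Mapping.lookup (scale c f) b = c * Poly_Mapping.lookup f b"
  unfolding scale_def by transfer (simp add: when_def)

definition variable :: "nat \<Rightarrow> 'k::field free_algebra" where
  "variable i = Poly_Mapping.single (Word [i]) 1"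

text \<open>The monomial \<open>x\<^sub>1 x\<^sub>2 \<dots> x\<^sub>n\<close>.\<close>

definition multilinear_monomial :: "nat \<Rightarrow> 'k::field free_algebra" where
  "multilinear_monomial n = prod_list (map variable [0..<n])"

lemma multilinear_monomial_eq:
  "multilinear_monomial n = Poly_Mapping.single (Word [0..<n]) (1 :: 'k::field)"
proof -
  have "prod_list (map variable xs) = Poly_Mapping.single (Word xs) (1 :: 'k)" for xs
    by (induction xs)
      (simp_all add: variable_def mult_single plus_word_def flip: zero_word_def)
  then show ?thesis
    by (simp add: multilinear_monomial_def)
qed


section \<open>T-ideals\<close>

definition two_sided_ideal_plus :: "'k::field free_algebra set \<Rightarrow> bool" where
  "two_sided_ideal_plus I \<longleftrightarrow>
     I \<subseteq> free_algebra_plus \<and> 0 \<in> I \<and>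
     (\<forall>f\<in>I. \<forall>g\<in>I. f + g \<in> I) \<and>
     (\<forall>c. \<forall>f\<in>I. scale c f \<in> I) \<and>
     (\<forall>f\<in>I. \<forall>g\<in>free_algebra_plus. f * g \<in> I \<and> g * f \<in> I)"

definition endomorphism_plus :: "('k::field free_algebra \<Rightarrow> 'k free_algebra) \<Rightarrow> bool" where
  "endomorphism_plus \<phi> \<longleftrightarrow>
     (\<forall>f\<in>free_algebra_plus. \<phi> f \<in> free_algebra_plus) \<and>
     (\<forall>f\<in>free_algebra_plus. \<forall>g\<in>free_algebra_plus.
        \<phi> (f + g) = \<phi> f + \<phi> g \<and> \<phi> (f * g) = \<phi> f * \<phi> g) \<and>
     (\<forall>c. \<forall>f\<in>free_algebra_plus. \<phi> (scale c f) = scale c (\<phi> f))"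

definition T_ideal :: "'k::field free_algebra set \<Rightarrow> bool" where
  "T_ideal I \<longleftrightarrow> two_sided_ideal_plus I \<and>
     (\<forall>\<phi>. endomorphism_plus \<phi> \<longrightarrow> (\<forall>f\<in>I. \<phi> f \<in> I))"

definition T_ideal_generated :: "'k::field free_algebra set \<Rightarrow> 'k free_algebra set" where
  "T_ideal_generated Z = T_ideal hull Z"


section \<open>Polynomial identities of a non-unital algebra\<close>

text \<open>
  A non-unital algebra is given by a carrier \<open>A\<close>, a product and a scalar multiplication; its
  addition is that of the ambient type. The product over a non-empty word needs no unit; the
  value for the empty word is never used for polynomials without constant term.
\<close>

fun eval_word :: "('b \<Rightarrow> 'b \<Rightarrow> 'b) \<Rightarrow> (nat \<Rightarrow> 'b) \<Rightarrow> nat list \<Rightarrow> 'b" where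
  "eval_word mul a [] = undefined"
| "eval_word mul a [i] = a i"
| "eval_word mul a (i # j # is) = mul (a i) (eval_word mul a (j # is))"

definition substitute ::
  "('b \<Rightarrow> 'b \<Rightarrow> 'b) \<Rightarrow> ('k \<Rightarrow> 'b \<Rightarrow> 'b) \<Rightarrow> (nat \<Rightarrow> 'b::comm_monoid_add)
    \<Rightarrow> 'k::field free_algebra \<Rightarrow> 'b" where
  "substitute mul scl a f =
     (\<Sum>w\<in>Poly_Mapping.keys f. scl (Poly_Mapping.lookup f w) (eval_word mul a (letters w)))"

definition identities ::
  "'b::comm_monoid_add set \<Rightarrow> ('b \<Rightarrow> 'b \<Rightarrow> 'b) \<Rightarrow> ('k \<Rightarrow> 'b \<Rightarrow> 'b)
    \<Rightarrow> 'k::field free_algebra set" where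
  "identities A mul scl =
     {f \<in> free_algebra_plus. \<forall>a. (\<forall>i. a i \<in> A) \<longrightarrow> substitute mul scl a f = 0}"


section \<open>Quivers and their principal subalgebras\<close>

text \<open>The maps \<open>s\<close> and \<open>t\<close> of a quiver are the fields \<open>tail\<close> and \<open>head\<close>.\<close>

locale quiver = fin_digraph Q for Q :: "('v, 'a) pre_digraph" (structure) +
  assumes verts_nonempty: "verts Q \<noteq> {}"
    and arcs_nonempty: "arcs Q \<noteq> {}"

definition paths :: "('v, 'a) pre_digraph \<Rightarrow> 'a list set" where
  "paths Q = {p. p \<noteq> [] \<and> (\<exists>u v. pre_digraph.awalk Q u p v)}"

definition path_source :: "('v, 'a) pre_digraph \<Rightarrow> 'a list \<Rightarrow> 'v" where
  "path_source Q p = tail Q (hd p)"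

definition path_target :: "('v, 'a) pre_digraph \<Rightarrow> 'a list \<Rightarrow> 'v" where
  "path_target Q p = head Q (last p)"

definition acyclic_quiver :: "('v, 'a) pre_digraph \<Rightarrow> bool" where
  "acyclic_quiver Q \<longleftrightarrow> \<not> (\<exists>p\<in>paths Q. path_source Q p = path_target Q p)"

definition longest_path_length :: "('v, 'a) pre_digraph \<Rightarrow> nat \<Rightarrow> bool" where
  "longest_path_length Q l \<longleftrightarrow>
     (\<exists>p\<in>paths Q. length p = l) \<and> (\<forall>p\<in>paths Q. length p \<le> l)"

definition principal_carrier :: "('v, 'a) pre_digraph \<Rightarrow> ('a list \<Rightarrow>\<^sub>0 'k::field) set" where
  "principal_carrier Q = {f. Poly_Mapping.keys f \<subseteq> paths Q}"

definition path_mult ::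
  "('v, 'a) pre_digraph \<Rightarrow> ('a list \<Rightarrow>\<^sub>0 'k::field) \<Rightarrow> ('a list \<Rightarrow>\<^sub>0 'k) \<Rightarrow> ('a list \<Rightarrow>\<^sub>0 'k)" where
  "path_mult Q f g =
     (\<Sum>p\<in>Poly_Mapping.keys f. \<Sum>q\<in>Poly_Mapping.keys g.
        if path_target Q p = path_source Q q
        then Poly_Mapping.single (p @ q) (Poly_Mapping.lookup f p * Poly_Mapping.lookup g q) else 0)"

lemma path_mult_single:
  "path_mult Q (Poly_Mapping.single p 1) (Poly_Mapping.single q (1 :: 'k::field)) =
     (if path_target Q p = path_source Q q then Poly_Mapping.single (p @ q) 1 else 0)"
  by (simp add: path_mult_def)

definition principal_identities :: "('v, 'a) pre_digraph \<Rightarrow> 'k::field free_algebra set" where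
  "principal_identities Q = identities (principal_carrier Q) (path_mult Q) scale"

end

theory Submission
  imports Defs
begin

text \<open>
  Both sides are the set of polynomials all of whose words have length at least \<open>n\<close>. For the
  identities, a word of length at least \<open>n\<close> can only take values in the span of paths of that
  length, of which there are none. Conversely, if \<open>w\<close> is a word of \<open>f\<close> of length \<open>k < n\<close>,
  choose a path \<open>p\<close> of length \<open>k\<close>; its arrows are distinct since the quiver is acyclic.
  Substituting for the variable \<open>i\<close> the sum of the arrows of \<open>p\<close> at the positions where \<open>w\<close>
  has the letter \<open>i\<close>, the path \<open>p\<close> occurs in the value of \<open>w\<close> with coefficient 1 and in the
  value of no other word, so the coefficient of \<open>p\<close> in the value of \<open>f\<close> is that of \<open>w\<close> in \<open>f\<close>.
\<close>

section \<open>Ideals of polynomials without short words\<close>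

text \<open>For \<open>n\<close> \<ge> 1 this is the \<open>n\<close>-th power of the ideal
  \<open>free_algebra_plus\<close>, hence a natural candidate for the T-ideal of a product of
  \<open>n\<close> variables.\<close>

definition word_ideal :: "nat \<Rightarrow> 'k::field free_algebra set" where
  "word_ideal n = {f. \<forall>w\<in>Poly_Mapping.keys f. n \<le> length (letters w)}"

lemma poly_mapping_expansion:
  "f = (\<Sum>w\<in>Poly_Mapping.keys f. Poly_Mapping.single w (Poly_Mapping.lookup f w))"
proof (rule poly_mapping_eqI)
  fix v
  show "Poly_Mapping.lookup f v = Poly_Mapping.lookup
      (\<Sum>w\<in>Poly_Mapping.keys f. Poly_Mapping.single w (Poly_Mapping.lookup f w)) v"
    by (simp add: lookup_sum lookup_single when_def in_keys_iff)
qed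

lemma scale_single [simp]:
  "scale c (Poly_Mapping.single w d) = Poly_Mapping.single w (c * d)"
  by (rule poly_mapping_eqI) (simp add: lookup_single when_def)

text \<open>Only the empty word has length 0. With this as the case \<open>n = 1\<close>, the degree
  count in \<open>mult_in_word_ideal\<close> also governs multiplication by elements of
  \<open>free_algebra_plus\<close>.\<close>

lemma free_algebra_plus_eq_word_ideal: "free_algebra_plus = word_ideal 1"
proof -
  have "1 \<le> length (letters w) \<longleftrightarrow> w \<noteq> 0" for w :: "nat word"
    by (cases w) (simp add: zero_word_def Suc_le_eq)
  then have "f \<in> word_ideal 1 \<longleftrightarrow> 0 \<notin> Poly_Mapping.keys f" for f :: "'a free_algebra"
    unfolding word_ideal_def by blast
  then show ?thesis
    unfolding free_algebra_plus_def by (auto simp only: in_keys_iff not_not mem_Collect_eq)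
qed

lemma word_ideal_antimono: "m \<le> n \<Longrightarrow> word_ideal n \<subseteq> word_ideal m"
  by (auto simp: word_ideal_def)

lemma zero_in_word_ideal: "0 \<in> word_ideal n"
  by (simp add: word_ideal_def)

lemma add_in_word_ideal:
  "f \<in> word_ideal n \<Longrightarrow> g \<in> word_ideal n \<Longrightarrow> f + g \<in> word_ideal n"
  using keys_add[of f g] by (fastforce simp: word_ideal_def)

lemma scale_in_word_ideal: "f \<in> word_ideal n \<Longrightarrow> scale c f \<in> word_ideal n"
  by (auto simp: word_ideal_def in_keys_iff)

lemma mult_in_word_ideal:
  assumes "f \<in> word_ideal m" and "g \<in> word_ideal n"
  shows "f * g \<in> word_ideal (m + n)"
  unfolding word_ideal_def
proof (clarify)
  fix w assume "w \<in> Poly_Mapping.keys (f * g)"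
  then obtain u v where "w = u + v" "u \<in> Poly_Mapping.keys f" "v \<in> Poly_Mapping.keys g"
    using keys_mult[of f g] by auto
  moreover from this assms have "m \<le> length (letters u)" "n \<le> length (letters v)"
    by (simp_all add: word_ideal_def)
  ultimately show "m + n \<le> length (letters w)"
    by (simp add: plus_word_def)
qed

lemma sum_in_word_ideal:
  "(\<And>x. x \<in> S \<Longrightarrow> f x \<in> word_ideal n) \<Longrightarrow> sum f S \<in> word_ideal n"
  by (induction S rule: infinite_finite_induct)
    (simp_all add: zero_in_word_ideal add_in_word_ideal)

lemma single_in_word_ideal: "n \<le> length xs \<Longrightarrow> Poly_Mapping.single (Word xs) c \<in> word_ideal n"
  by (simp add: word_ideal_def)

lemma two_sided_ideal_plus_word_ideal:
  assumes "1 \<le> n"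
  shows "two_sided_ideal_plus (word_ideal n)"
  unfolding two_sided_ideal_plus_def free_algebra_plus_eq_word_ideal
proof (intro conjI allI ballI)
  show "word_ideal n \<subseteq> word_ideal 1"
    using assms by (rule word_ideal_antimono)
next
  fix f g :: "'a free_algebra" assume "f \<in> word_ideal n" "g \<in> word_ideal 1"
  then show "f * g \<in> word_ideal n" "g * f \<in> word_ideal n"
    using mult_in_word_ideal[of f n g 1] mult_in_word_ideal[of g 1 f n]
      word_ideal_antimono[of n "n + 1"] by auto
qed (simp_all add: zero_in_word_ideal add_in_word_ideal scale_in_word_ideal)

section \<open>Stability of \<open>word_ideal\<close> under endomorphisms\<close>

lemma endomorphism_plus_zero:
  assumes "endomorphism_plus \<phi>"
  shows "\<phi> 0 = 0"
proof -
  have "0 \<in> free_algebra_plus"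
    by (simp add: free_algebra_plus_def)
  with assms have "\<phi> (0 + 0) = \<phi> 0 + \<phi> 0"
    unfolding endomorphism_plus_def by blast
  then show ?thesis
    by simp
qed

text \<open>The summands must lie in \<open>free_algebra_plus\<close>, because
  \<open>endomorphism_plus\<close> prescribes nothing about values outside it.\<close>

lemma endomorphism_plus_sum:
  assumes "endomorphism_plus \<phi>" and "\<And>x. x \<in> S \<Longrightarrow> f x \<in> free_algebra_plus"
  shows "\<phi> (sum f S) = (\<Sum>x\<in>S. \<phi> (f x))"
  using assms(2)
proof (induction S rule: infinite_finite_induct)
  case (insert x S)
  have "sum f S \<in> free_algebra_plus"
    using insert.prems by (simp add: free_algebra_plus_eq_word_ideal sum_in_word_ideal)
  then have "\<phi> (f x + sum f S) = \<phi> (f x) + \<phi> (sum f S)"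
    using assms(1) insert.prems unfolding endomorphism_plus_def by blast
  then show ?case
    using insert by simp
qed (simp_all add: endomorphism_plus_zero assms(1))

text \<open>The image of a word is the product of the images of its letters, each free of a constant
  term, so at least one degree is gained per letter.\<close>

lemma endomorphism_plus_word:
  assumes "endomorphism_plus \<phi>" and "xs \<noteq> []"
  shows "\<phi> (Poly_Mapping.single (Word xs) 1) \<in> word_ideal (length xs)"
  using assms(2)
proof (induction xs rule: list_nonempty_induct)
  case (single x)
  then show ?case
    using assms(1) single_in_word_ideal[of 1 "[x]" "1 :: 'a"]
    by (simp add: endomorphism_plus_def free_algebra_plus_eq_word_ideal)
next
  case (cons x xs)
  let ?x = "Poly_Mapping.single (Word [x]) (1 :: 'a)"
  let ?xs = "Poly_Mapping.single (Word xs) (1 :: 'a)"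
  have plus: "?x \<in> word_ideal 1" "?xs \<in> word_ideal 1"
    using cons.hyps by (simp_all add: single_in_word_ideal Suc_le_eq)
  have "Poly_Mapping.single (Word (x # xs)) 1 = ?x * ?xs"
    by (simp add: mult_single plus_word_def)
  then have "\<phi> (Poly_Mapping.single (Word (x # xs)) 1) = \<phi> ?x * \<phi> ?xs"
    using assms(1) plus by (simp add: endomorphism_plus_def free_algebra_plus_eq_word_ideal)
  moreover have "\<phi> ?x \<in> word_ideal 1"
    using assms(1) plus by (simp add: endomorphism_plus_def free_algebra_plus_eq_word_ideal)
  ultimately show ?case
    using mult_in_word_ideal[OF _ cons.IH] by fastforce
qed

lemma T_ideal_word_ideal:
  assumes "1 \<le> n"
  shows "T_ideal (word_ideal n)"
  unfolding T_ideal_def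
proof (intro conjI allI impI ballI two_sided_ideal_plus_word_ideal assms)
  fix \<phi> :: "'a free_algebra \<Rightarrow> 'a free_algebra" and f :: "'a free_algebra"
  assume \<phi>: "endomorphism_plus \<phi>" and f: "f \<in> word_ideal n"
  let ?m = "\<lambda>w. Poly_Mapping.single w (1 :: 'a)"
  have word: "?m w \<in> free_algebra_plus \<and> \<phi> (?m w) \<in> word_ideal n"
    if w: "w \<in> Poly_Mapping.keys f" for w
  proof -
    have len: "n \<le> length (letters w)"
      using f w by (simp add: word_ideal_def)
    then have "letters w \<noteq> []"
      using assms by auto
    then show ?thesis
      using single_in_word_ideal[of 1 "letters w" "1 :: 'a"] endomorphism_plus_word[OF \<phi>, of "letters w"]
        word_ideal_antimono[OF len]
      by (auto simp: free_algebra_plus_eq_word_ideal Suc_le_eq)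
  qed
  \<comment> \<open>The coefficients become scalars in front of monic words, the form in which
    \<open>endomorphism_plus\<close> gives linearity. \<open>scale_single\<close> would merge them
    again and is therefore disabled below.\<close>
  have "\<phi> f = \<phi> (\<Sum>w\<in>Poly_Mapping.keys f. scale (Poly_Mapping.lookup f w) (?m w))"
    by (simp flip: poly_mapping_expansion)
  also have "\<dots> = (\<Sum>w\<in>Poly_Mapping.keys f. \<phi> (scale (Poly_Mapping.lookup f w) (?m w)))"
    using word by (intro endomorphism_plus_sum[OF \<phi>])
      (simp add: free_algebra_plus_eq_word_ideal scale_in_word_ideal del: scale_single)
  also have "\<dots> = (\<Sum>w\<in>Poly_Mapping.keys f. scale (Poly_Mapping.lookup f w) (\<phi> (?m w)))"
    using \<phi> word by (intro sum.cong) (auto simp: endomorphism_plus_def simp del: scale_single)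
  finally show "\<phi> f \<in> word_ideal n"
    using word by (simp add: sum_in_word_ideal scale_in_word_ideal)
qed


section \<open>Renaming variables\<close>

text \<open>The endomorphism sending the variable \<open>i\<close> to the variable
  \<open>\<sigma> i\<close>. Such substitutions carry \<open>multilinear_monomial n\<close> to every
  word of length \<open>n\<close>.\<close>

definition rename :: "(nat \<Rightarrow> nat) \<Rightarrow> 'k::field free_algebra \<Rightarrow> 'k free_algebra" where
  "rename \<sigma> f = (\<Sum>w\<in>Poly_Mapping.keys f.
     Poly_Mapping.single (Word (map \<sigma> (letters w))) (Poly_Mapping.lookup f w))"

text \<open>Allows polynomials with different supports to be summed over a common index set, as
  additivity requires.\<close>

lemma rename_superset:
  assumes "finite S" and "Poly_Mapping.keys f \<subseteq> S"
  shows "rename \<sigma> f =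
    (\<Sum>w\<in>S. Poly_Mapping.single (Word (map \<sigma> (letters w))) (Poly_Mapping.lookup f w))"
  unfolding rename_def using assms
  by (intro sum.mono_neutral_left) (auto simp: in_keys_iff)

lemma rename_zero [simp]: "rename \<sigma> 0 = 0"
  by (simp add: rename_def)

lemma rename_single [simp]:
  "rename \<sigma> (Poly_Mapping.single w c) = Poly_Mapping.single (Word (map \<sigma> (letters w))) c"
  by (simp add: rename_def)

lemma rename_add: "rename \<sigma> (f + g) = rename \<sigma> f + rename \<sigma> g"
proof -
  let ?S = "Poly_Mapping.keys f \<union> Poly_Mapping.keys g"
  show ?thesis
    using keys_add[of f g]
    by (simp add: rename_superset[of ?S] lookup_add single_add sum.distrib)
qed

lemma rename_sum: "rename \<sigma> (sum f S) = (\<Sum>x\<in>S. rename \<sigma> (f x))"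
  by (induction S rule: infinite_finite_induct) (simp_all add: rename_add)

lemma rename_mult: "rename \<sigma> (f * g) = rename \<sigma> f * rename \<sigma> g"
proof -
  let ?m = "\<lambda>f w. Poly_Mapping.single w (Poly_Mapping.lookup f w)"
  have "rename \<sigma> (f * g) =
      rename \<sigma> ((\<Sum>u\<in>Poly_Mapping.keys f. ?m f u) * (\<Sum>v\<in>Poly_Mapping.keys g. ?m g v))"
    by (simp flip: poly_mapping_expansion)
  also have "\<dots> = rename \<sigma> f * rename \<sigma> g"
    by (simp add: sum_product mult_single rename_sum plus_word_def rename_def[of _ f] rename_def[of _ g])
  finally show ?thesis .
qed

lemma rename_scale: "rename \<sigma> (scale c f) = scale c (rename \<sigma> f)"
proof -
  have "Poly_Mapping.keys (scale c f) \<subseteq> Poly_Mapping.keys f"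
    by (auto simp: in_keys_iff)
  then show ?thesis
    by (intro poly_mapping_eqI)
      (simp add: rename_superset[of "Poly_Mapping.keys f"] lookup_sum lookup_single
        sum_distrib_left when_def if_distrib cong: if_cong)
qed

lemma endomorphism_plus_rename: "endomorphism_plus (rename \<sigma>)"
proof -
  have "rename \<sigma> f \<in> word_ideal n" if "f \<in> word_ideal n" for n and f :: "'a free_algebra"
    unfolding rename_def using that
    by (intro sum_in_word_ideal single_in_word_ideal) (simp add: word_ideal_def)
  then show ?thesis
    by (simp add: endomorphism_plus_def free_algebra_plus_eq_word_ideal
        rename_add rename_mult rename_scale)
qed

section \<open>Generation of \<open>word_ideal\<close> by the multilinear monomial\<close>

lemma word_in_T_ideal:
  assumes T: "T_ideal I" and mono: "multilinear_monomial n \<in> I" and len: "n \<le> length xs"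
  shows "(Poly_Mapping.single (Word xs) 1 :: 'k::field free_algebra) \<in> I"
proof -
  \<comment> \<open>Renaming along \<open>xs\<close> yields only the prefix of length
    \<open>n\<close>; the remaining letters come from multiplication on the right.\<close>
  define \<sigma> where "\<sigma> = (\<lambda>i. xs ! i)"
  have "map \<sigma> [0..<n] = take n xs"
    using len by (simp add: \<sigma>_def list_eq_iff_nth_eq)
  then have "rename \<sigma> (multilinear_monomial n) =
      (Poly_Mapping.single (Word (take n xs)) 1 :: 'k free_algebra)"
    by (simp add: multilinear_monomial_eq)
  then have pre: "(Poly_Mapping.single (Word (take n xs)) 1 :: 'k free_algebra) \<in> I"
    using T mono endomorphism_plus_rename unfolding T_ideal_def by metis
  show ?thesis
  \<comment> \<open>An empty suffix would be the unit, which is not in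
    \<open>free_algebra_plus\<close>, so ideal closure covers only the other case.\<close>
  proof (cases "drop n xs = []")
    case True
    with len pre show ?thesis by simp
  next
    case False
    then have "(Poly_Mapping.single (Word (drop n xs)) 1 :: 'k free_algebra) \<in> free_algebra_plus"
      unfolding free_algebra_plus_eq_word_ideal
      by (intro single_in_word_ideal) (simp add: Suc_le_eq)
    with T pre have "(Poly_Mapping.single (Word (take n xs)) 1 :: 'k free_algebra) *
        Poly_Mapping.single (Word (drop n xs)) 1 \<in> I"
      by (simp add: T_ideal_def two_sided_ideal_plus_def)
    then show ?thesis
      by (simp add: mult_single plus_word_def)
  qed
qed

lemma word_ideal_subset_T_ideal:
  assumes T: "T_ideal I" and mono: "multilinear_monomial n \<in> I"
  shows "word_ideal n \<subseteq> I"
proof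
  fix f :: "'a free_algebra" assume f: "f \<in> word_ideal n"
  have I: "0 \<in> I" "\<And>f g. f \<in> I \<Longrightarrow> g \<in> I \<Longrightarrow> f + g \<in> I" "\<And>c f. f \<in> I \<Longrightarrow> scale c f \<in> I"
    using T by (simp_all add: T_ideal_def two_sided_ideal_plus_def)
  have sum: "(\<And>x. x \<in> S \<Longrightarrow> g x \<in> I) \<Longrightarrow> sum g S \<in> I" for S :: "nat word set" and g
    by (induction S rule: infinite_finite_induct) (simp_all add: I)
  have "Poly_Mapping.single w (Poly_Mapping.lookup f w) \<in> I" if "w \<in> Poly_Mapping.keys f" for w
  proof -
    have "Poly_Mapping.single w 1 \<in> I"
      using word_in_T_ideal[OF T mono, of "letters w"] f that by (simp add: word_ideal_def)
    then show ?thesis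
      using I(3)[of "Poly_Mapping.single w 1" "Poly_Mapping.lookup f w"] by simp
  qed
  then have "(\<Sum>w\<in>Poly_Mapping.keys f. Poly_Mapping.single w (Poly_Mapping.lookup f w)) \<in> I"
    by (rule sum)
  then show "f \<in> I"
    by (simp flip: poly_mapping_expansion)
qed

lemma T_ideal_generated_multilinear_monomial:
  assumes "1 \<le> n"
  shows "T_ideal_generated {multilinear_monomial n :: 'k::field free_algebra} = word_ideal n"
  unfolding T_ideal_generated_def
proof (rule hull_unique)
  show "{multilinear_monomial n} \<subseteq> word_ideal n"
    by (simp add: multilinear_monomial_eq single_in_word_ideal)
  show "T_ideal (word_ideal n)"
    using assms by (rule T_ideal_word_ideal)
qed (simp add: word_ideal_subset_T_ideal)


section \<open>Paths of a quiver\<close>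

lemma Nil_notin_paths [simp]: "[] \<notin> paths Q"
  by (simp add: paths_def)

context quiver
begin

text \<open>Replaces the existentially quantified end vertices in \<open>paths\<close> by a local
  condition at the first arrow, suited to induction on lists.\<close>

lemma Cons_in_paths_iff:
  "e # p \<in> paths Q \<longleftrightarrow>
     e \<in> arcs Q \<and> (p = [] \<or> p \<in> paths Q \<and> head Q e = path_source Q p)"
proof -
  have step: "e # p \<in> paths Q \<longleftrightarrow> e \<in> arcs Q \<and> (\<exists>v. awalk (head Q e) p v)" for e p
    unfolding paths_def using awalk_Cons_iff by blast
  show ?thesis
  proof (cases p)
    case Nil
    then show ?thesis
      using step[of e p] head_in_verts awalk_Nil_iff by auto
  next
    case (Cons a as)
    have "(\<exists>v. awalk (head Q e) p v) \<longleftrightarrow> p \<in> paths Q \<and> head Q e = path_source Q p"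
      unfolding Cons step path_source_def list.sel using awalk_Cons_iff by blast
    then show ?thesis
      using Cons step[of e p] by blast
  qed
qed

text \<open>For paths \<open>p\<close> and \<open>q\<close>, the matching condition in
  \<open>path_mult\<close> thus says exactly that their concatenation is a path.\<close>

lemma append_in_paths_iff:
  assumes "p \<noteq> []" and "q \<noteq> []"
  shows "p @ q \<in> paths Q \<longleftrightarrow>
     p \<in> paths Q \<and> q \<in> paths Q \<and> path_target Q p = path_source Q q"
  using assms(1)
proof (induction p rule: list_nonempty_induct)
  case (single e)
  then show ?case
    using assms(2) by (auto simp: Cons_in_paths_iff path_target_def)
next
  case (cons e p)
  then show ?case
    by (auto simp: Cons_in_paths_iff[of e] path_target_def path_source_def)
qed

text \<open>If an arrow \<open>e\<close> occurred twice, the segment from its first occurrence up to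
  just before a later one would end where \<open>e\<close> starts: an oriented cycle.\<close>

lemma distinct_path:
  assumes acyclic: "acyclic_quiver Q" and path: "p \<in> paths Q"
  shows "distinct p"
proof (rule ccontr)
  assume "\<not> distinct p"
  then obtain xs ys zs e where "p = xs @ (e # ys) @ (e # zs)"
    by (auto dest: not_distinct_decomp)
  with path have "(e # ys) @ (e # zs) \<in> paths Q"
    by (cases "xs = []") (simp_all add: append_in_paths_iff)
  then have "e # ys \<in> paths Q" "path_target Q (e # ys) = path_source Q (e # zs)"
    by (simp_all only: append_in_paths_iff list.simps not_False_eq_True)
  with acyclic show False
    by (force simp: acyclic_quiver_def path_source_def)
qed

lemma paths_of_smaller_length:
  assumes "p \<in> paths Q" and "1 \<le> k" and "k \<le> length p"
  shows "\<exists>q\<in>paths Q. length q = k"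
\<comment> \<open>For \<open>k = length p\<close> the suffix is empty and
  \<open>append_in_paths_iff\<close> does not apply; otherwise the prefix of length \<open>k\<close>
  serves.\<close>
proof (cases "k = length p")
  case False
  then have "take k p @ drop k p \<in> paths Q" "take k p \<noteq> []" "drop k p \<noteq> []"
    using assms by auto
  then have "take k p \<in> paths Q"
    using append_in_paths_iff by blast
  then show ?thesis
    using assms(3) by (intro bexI[of _ "take k p"]) simp_all
qed (use assms in blast)


section \<open>Values of words in the principal subalgebra\<close>

text \<open>Only an inclusion: contributions of different factorisations of the same path may
  cancel.\<close>

lemma keys_path_mult:
  "Poly_Mapping.keys (path_mult Q f g) \<subseteq>
     {p @ q |p q. p \<in> Poly_Mapping.keys f \<and> q \<in> Poly_Mapping.keys g \<and>
       path_target Q p = path_source Q q}"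
proof
  fix r assume "r \<in> Poly_Mapping.keys (path_mult Q f g)"
  then obtain p q where "p \<in> Poly_Mapping.keys f" "q \<in> Poly_Mapping.keys g"
    "r \<in> Poly_Mapping.keys (if path_target Q p = path_source Q q
        then Poly_Mapping.single (p @ q) (Poly_Mapping.lookup f p * Poly_Mapping.lookup g q) else 0)"
    by (auto simp: path_mult_def in_keys_iff lookup_sum elim!: sum.not_neutral_contains_not_neutral)
  then show "r \<in> {p @ q |p q. p \<in> Poly_Mapping.keys f \<and> q \<in> Poly_Mapping.keys g \<and>
       path_target Q p = path_source Q q}"
    by (auto split: if_splits)
qed

text \<open>Each substituted element contributes a path with at least one arrow, and lengths add
  under concatenation.\<close>

lemma keys_eval_word:
  assumes "\<And>i. a i \<in> principal_carrier Q" and "xs \<noteq> []"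
  shows "Poly_Mapping.keys (eval_word (path_mult Q) a xs) \<subseteq>
    {p \<in> paths Q. length xs \<le> length p}"
  using assms(2)
proof (induction xs rule: list_nonempty_induct)
  case (single i)
  then show ?case
    using assms(1)[of i] by (auto simp: principal_carrier_def Suc_le_eq)
next
  case (cons i xs)
  show ?case
  proof
    fix r assume "r \<in> Poly_Mapping.keys (eval_word (path_mult Q) a (i # xs))"
    then have "r \<in> Poly_Mapping.keys (path_mult Q (a i) (eval_word (path_mult Q) a xs))"
      using cons.hyps by (cases xs) simp_all
    then obtain p q where r: "r = p @ q" and p: "p \<in> Poly_Mapping.keys (a i)"
      and q: "q \<in> Poly_Mapping.keys (eval_word (path_mult Q) a xs)"
      and pq: "path_target Q p = path_source Q q"
      using keys_path_mult by blast
    have "p \<in> paths Q" "q \<in> paths Q" "length xs \<le> length q"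
      using p q assms(1)[of i] cons.IH by (auto simp: principal_carrier_def)
    moreover from this have "p \<noteq> []" "q \<noteq> []"
      by auto
    ultimately have "p @ q \<in> paths Q" "1 \<le> length p" "length xs \<le> length q"
      using pq by (simp_all add: append_in_paths_iff Suc_le_eq)
    then show "r \<in> {p \<in> paths Q. length (i # xs) \<le> length p}"
      by (simp add: r)
  qed
qed

text \<open>When the left factor is supported in length one, \<open>e # r\<close> has the single
  factorisation \<open>[e]\<close> times \<open>r\<close>, so no cancellation can occur.\<close>

lemma lookup_path_mult_Cons:
  assumes "\<And>p. p \<in> Poly_Mapping.keys f \<Longrightarrow> length p = 1" and "head Q e = path_source Q r"
  shows "Poly_Mapping.lookup (path_mult Q f g) (e # r) =
    Poly_Mapping.lookup f [e] * Poly_Mapping.lookup g r"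
proof -
  let ?c = "Poly_Mapping.lookup f [e] * Poly_Mapping.lookup g r"
  have "Poly_Mapping.lookup (path_mult Q f g) (e # r) =
      (\<Sum>p\<in>Poly_Mapping.keys f. \<Sum>q\<in>Poly_Mapping.keys g.
        if p = [e] then if q = r then ?c else 0 else 0)"
    unfolding path_mult_def lookup_sum
  proof (intro sum.cong refl)
    fix p q assume "p \<in> Poly_Mapping.keys f"
    then obtain e' where "p = [e']"
      using assms(1) by (auto simp: length_Suc_conv)
    then show "Poly_Mapping.lookup (if path_target Q p = path_source Q q
        then Poly_Mapping.single (p @ q) (Poly_Mapping.lookup f p * Poly_Mapping.lookup g q)
        else 0) (e # r) = (if p = [e] then if q = r then ?c else 0 else 0)"
      using assms(2) by (auto simp: lookup_single when_def path_target_def)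
  qed
  \<comment> \<open>If \<open>r\<close> is not a key of \<open>g\<close>, the inner sum is empty,
    but then \<open>?c\<close> is zero as well.\<close>
  also have "\<dots> = (\<Sum>p\<in>Poly_Mapping.keys f. if p = [e] then ?c else 0)"
    by (intro sum.cong) (auto simp: in_keys_iff)
  also have "\<dots> = ?c"
    by (simp add: in_keys_iff)
  finally show ?thesis .
qed

text \<open>Under a substitution homogeneous of degree one, a path arises from a word only by
  matching letters and arrows position by position.\<close>

lemma lookup_eval_word:
  assumes a: "\<And>i. a i \<in> principal_carrier Q"
    and deg: "\<And>i p. p \<in> Poly_Mapping.keys (a i) \<Longrightarrow> length p = 1"
    and "xs \<noteq> []" and "r \<in> paths Q"
  shows "Poly_Mapping.lookup (eval_word (path_mult Q) a xs) r =
    (if length xs = length r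
     then \<Prod>(i, e)\<leftarrow>zip xs r. Poly_Mapping.lookup (a i) [e] else 0)"
  using assms(3,4)
proof (induction xs arbitrary: r rule: list_nonempty_induct)
  case (single i)
  have "Poly_Mapping.lookup (a i) r = 0" if "length r \<noteq> 1"
    using deg[of r i] that by (auto simp: in_keys_iff)
  then show ?case
    \<comment> \<open>This rule separates lists of length 0, 1 and at least 2.\<close>
    by (cases r rule: remdups_adj.cases) auto
next
  case (cons i xs)
  show ?case
  \<comment> \<open>Paths that are too short are excluded by \<open>keys_eval_word\<close>; for
    those that are too long the zero comes from the induction hypothesis.\<close>
  proof (cases "length (i # xs) \<le> length r")
    case False
    then have "r \<notin> Poly_Mapping.keys (eval_word (path_mult Q) a (i # xs))"
      using keys_eval_word[of a "i # xs"] a by auto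
    with False show ?thesis
      by (auto simp: in_keys_iff)
  next
    case True
    then obtain e r' where r: "r = e # r'"
      by (cases r) auto
    with True cons.hyps have r': "r' \<noteq> []"
      by auto
    then have path: "r' \<in> paths Q" "head Q e = path_source Q r'"
      using cons.prems by (simp_all add: r Cons_in_paths_iff)
    have "eval_word (path_mult Q) a (i # xs) = path_mult Q (a i) (eval_word (path_mult Q) a xs)"
      using cons.hyps by (cases xs) simp_all
    then show ?thesis
      using cons.IH[OF path(1)] lookup_path_mult_Cons[of "a i", OF deg[of _ i] path(2)] by (simp add: r)
  qed
qed

section \<open>The two inclusions between identities and \<open>word_ideal\<close>\<close>

lemma word_ideal_subset_principal_identities:
  assumes len: "\<forall>p\<in>paths Q. length p < n" and "1 \<le> n"
  shows "word_ideal n \<subseteq> principal_identities Q"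
proof
  fix f :: "'k::field free_algebra" assume f: "f \<in> word_ideal n"
  have "substitute (path_mult Q) scale a f = 0" if a: "\<And>i. a i \<in> principal_carrier Q" for a
    unfolding substitute_def
  proof (intro sum.neutral ballI)
    fix w assume "w \<in> Poly_Mapping.keys f"
    with f have n: "n \<le> length (letters w)"
      by (simp add: word_ideal_def)
    then have "Poly_Mapping.keys (eval_word (path_mult Q) a (letters w)) \<subseteq>
        {p \<in> paths Q. length (letters w) \<le> length p}"
      using \<open>1 \<le> n\<close> by (intro keys_eval_word a) auto
    also have "\<dots> = {}"
      using len n by force
    finally have "eval_word (path_mult Q) a (letters w) = 0"
      by (intro poly_mapping_eqI) (auto simp: in_keys_iff)
    then show "scale (Poly_Mapping.lookup f w) (eval_word (path_mult Q) a (letters w)) = 0"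
      by (intro poly_mapping_eqI) simp
  qed
  then show "f \<in> principal_identities Q"
    using f word_ideal_antimono[OF \<open>1 \<le> n\<close>]
    by (auto simp: principal_identities_def identities_def free_algebra_plus_eq_word_ideal)
qed

text \<open>Reading off the coefficient of \<open>p\<close> after this substitution is a linear
  functional that isolates the coefficient of the word \<open>xs\<close>.\<close>

lemma substitution_detecting_word:
  fixes xs :: "nat list"
  assumes p: "p \<in> paths Q" "distinct p" and len: "length xs = length p"
  obtains a :: "nat \<Rightarrow> 'a list \<Rightarrow>\<^sub>0 'k::field"
  where "\<And>i. a i \<in> principal_carrier Q"
    and "\<And>ys. ys \<noteq> [] \<Longrightarrow>
      Poly_Mapping.lookup (eval_word (path_mult Q) a ys) p = (if ys = xs then 1 else 0)"
proof
  define a :: "nat \<Rightarrow> 'a list \<Rightarrow>\<^sub>0 'k" where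
    "a i = (\<Sum>j | j < length p \<and> xs ! j = i. Poly_Mapping.single [p ! j] 1)" for i
  have keys: "Poly_Mapping.keys (a i) \<subseteq> (\<lambda>e. [e]) ` set p" for i
    using keys_sum[of "\<lambda>j. Poly_Mapping.single [p ! j] 1" "{j. j < length p \<and> xs ! j = i}"]
    by (auto simp: a_def lookup_sum lookup_single when_def in_keys_iff
        elim!: sum.not_neutral_contains_not_neutral split: if_splits)
  have "set p \<subseteq> arcs Q"
    using p(1) by (auto simp: paths_def)
  then show carrier: "a i \<in> principal_carrier Q" for i
    by (auto simp: principal_carrier_def Cons_in_paths_iff dest!: subsetD[OF keys])
  \<comment> \<open>Distinctness of \<open>p\<close> enters here: the arrow \<open>p ! j\<close>
    sits at no other position, so only \<open>xs ! j\<close> decides the coefficient.\<close>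
  have coeff: "Poly_Mapping.lookup (a i) [p ! j] = (if xs ! j = i then 1 else 0)"
    if "j < length p" for i j
  proof -
    have "Poly_Mapping.lookup (a i) [p ! j] =
        (\<Sum>j' | j' < length p \<and> xs ! j' = i. if j' = j then 1 else 0)"
      unfolding a_def lookup_sum using that p(2)
      by (intro sum.cong) (auto simp: lookup_single when_def nth_eq_iff_index_eq)
    also have "\<dots> = (if xs ! j = i then 1 else 0)"
      using that by simp
    finally show ?thesis .
  qed
  fix ys :: "nat list" assume "ys \<noteq> []"
  then have "Poly_Mapping.lookup (eval_word (path_mult Q) a ys) p =
      (if length ys = length p then \<Prod>(i, e)\<leftarrow>zip ys p. Poly_Mapping.lookup (a i) [e] else 0)"
    by (intro lookup_eval_word carrier p(1)) (auto dest: subsetD[OF keys])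
  also have "\<dots> = (if ys = xs then 1 else 0)"
  proof (cases "length ys = length p")
    case True
    \<comment> \<open>A product of indicators, equal to 1 exactly when \<open>ys\<close> and
      \<open>xs\<close> agree at every position.\<close>
    then have "(\<Prod>(i, e)\<leftarrow>zip ys p. Poly_Mapping.lookup (a i) [e]) =
        (\<Prod>j<length p. if xs ! j = ys ! j then 1 else 0)"
      by (simp add: prod.list_conv_set_nth coeff atLeast0LessThan)
    also have "\<dots> = (if ys = xs then 1 else 0)"
      using True len by (auto simp: list_eq_iff_nth_eq) (metis lessThan_iff)
    finally show ?thesis
      using True by simp
  qed (use len in auto)
  finally show "Poly_Mapping.lookup (eval_word (path_mult Q) a ys) p = (if ys = xs then 1 else 0)" .
qed

lemma principal_identities_subset_word_ideal:
  assumes acyclic: "acyclic_quiver Q" and p: "p \<in> paths Q"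
  shows "principal_identities Q \<subseteq> (word_ideal (Suc (length p)) :: 'k::field free_algebra set)"
proof
  fix f :: "'k free_algebra" assume f: "f \<in> principal_identities Q"
  \<comment> \<open>This keeps the \<open>undefined\<close> value of \<open>eval_word\<close> at the
    empty word out of the sum.\<close>
  have plus: "letters w \<noteq> []" if "w \<in> Poly_Mapping.keys f" for w
    using f that
    by (force simp: principal_identities_def identities_def free_algebra_plus_eq_word_ideal
        word_ideal_def)
  show "f \<in> word_ideal (Suc (length p))"
  proof (rule ccontr)
    assume "f \<notin> word_ideal (Suc (length p))"
    then obtain w where w: "w \<in> Poly_Mapping.keys f" "length (letters w) \<le> length p"
      by (auto simp: word_ideal_def not_le less_Suc_eq_le)
    \<comment> \<open>The word may be shorter than \<open>p\<close>, so a path of exactly its length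
      is taken.\<close>
    then obtain q where q: "q \<in> paths Q" "length (letters w) = length q"
      using paths_of_smaller_length[OF p, of "length (letters w)"] plus[of w]
      by (auto simp: Suc_le_eq)
    obtain a :: "nat \<Rightarrow> 'a list \<Rightarrow>\<^sub>0 'k" where a: "\<And>i. a i \<in> principal_carrier Q"
      and eval: "\<And>ys. ys \<noteq> [] \<Longrightarrow> Poly_Mapping.lookup (eval_word (path_mult Q) a ys) q =
        (if ys = letters w then 1 else 0)"
      using substitution_detecting_word[OF q(1) distinct_path[OF acyclic q(1)] q(2)] by blast
    have "0 = Poly_Mapping.lookup (substitute (path_mult Q) scale a f) q"
      using f a by (simp add: principal_identities_def identities_def)
    also have "\<dots> = (\<Sum>v\<in>Poly_Mapping.keys f. if v = w then Poly_Mapping.lookup f v else 0)"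
      unfolding substitute_def lookup_sum
      by (intro sum.cong) (auto simp: eval plus word.expand)
    also have "\<dots> = Poly_Mapping.lookup f w"
      using w(1) by simp
    finally show False
      using w(1) by (simp add: in_keys_iff)
  qed
qed

end

theorem theorem1p2:
  fixes Q :: "('v, 'a) pre_digraph" and n :: nat
  assumes "quiver Q"
    and "acyclic_quiver Q"
    and "longest_path_length Q (n - 1)"
  shows "(principal_identities Q :: 'k::field_char_0 free_algebra set)
           = T_ideal_generated {multilinear_monomial n}"
proof -
  interpret quiver Q by fact
  obtain p where p: "p \<in> paths Q" "length p = n - 1" and max: "\<forall>q\<in>paths Q. length q \<le> n - 1"
    using assms(3) by (auto simp: longest_path_length_def)
  \<comment> \<open>Subtraction is truncated, so \<open>n = 0\<close> must be excluded: the path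
    \<open>p\<close> is non-empty and has length \<open>n - 1\<close>.\<close>
  have "n - 1 \<noteq> 0"
    using p by auto
  then have n: "1 \<le> n" "Suc (length p) = n"
    using p(2) by simp_all
  have "\<forall>q\<in>paths Q. length q < n"
    using max n by fastforce
  then have "principal_identities Q = (word_ideal n :: 'k free_algebra set)"
    using principal_identities_subset_word_ideal[OF assms(2) p(1), unfolded n(2)]
      word_ideal_subset_principal_identities[OF _ n(1)] by blast
  then show ?thesis
    by (simp only: T_ideal_generated_multilinear_monomial[OF n(1)])
qed

end
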